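(* For integers $N,k\ge0$ let $T(N,k)$ denote the number of tilings of an $N$-board using squares and $(1,1)$-fences that contain exactly $k$ fences (with $T(0,0)=1$). Let $\bar R(n,k)$ be the coefficient of $x^n$ in the power series expansion of $\dfrac{1}{(1-x)(1-x^2)}\left(\dfrac{x}{(1-x)^2}\right)^k$ (the $(n,k)$th entry of the Riordan array $(1/[(1-x)(1-x^2)],x/(1-x)^2)$). Then for all integers $0\le k\le n$, \[ T(2n+1,k)=\bar R(n,n-k). \]
   Context: An $N$-board is a $1\times N$ row of $N$ unit cells. A square is a $1\times1$ tile. A $(1,1)$-fence is a tile consisting of two $1\times1$ posts separated by a one-cell gap; placed on a board its posts occupy cells $i$ and $i+2$, and the gap cell must be covered by another tile. A tiling covers every cell exactly once. *)

theory Defs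
  imports Complex_Main "HOL-Computational_Algebra.Formal_Power_Series"
begin

text \<open>
  The cells of an \<open>N\<close>-board are numbered \<open>1, \<dots>, N\<close>. A tile comes with its position:
  \<open>Square i\<close> lies on cell \<open>i\<close>, and \<open>Fence i\<close> is the (1,1)-fence whose left post lies on
  cell \<open>i\<close>.
\<close>

datatype tile = Square nat | Fence nat

fun cells :: "tile \<Rightarrow> nat set" where
  "cells (Square i) = {i}"
| "cells (Fence i) = {i, i + 2}"

text \<open>
  The gap cell \<open>i + 1\<close> of a fence \<open>Fence i\<close> on the board is itself a cell of the board, and not
  one of the cells of that fence, so exact covering already forces another tile to cover it.
\<close>

definition is_tiling :: "nat \<Rightarrow> tile set \<Rightarrow> bool" where
  "is_tiling N S \<longleftrightarrow>
     (\<forall>t\<in>S. cells t \<subseteq> {1..N}) \<and> (\<forall>c\<in>{1..N}. \<exists>!t. t \<in> S \<and> c \<in> cells t)"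

definition num_fences :: "tile set \<Rightarrow> nat" where
  "num_fences S = card {t \<in> S. \<exists>i. t = Fence i}"

definition T :: "nat \<Rightarrow> nat \<Rightarrow> nat" where
  "T N k = card {S. is_tiling N S \<and> num_fences S = k}"

lemma is_tiling_0_iff: "is_tiling 0 S \<longleftrightarrow> S = {}"
proof -
  have "cells t \<noteq> {}" for t by (cases t) auto
  then show ?thesis by (auto simp: is_tiling_def)
qed

lemma T_0_0: "T 0 0 = 1"
proof -
  have "{S. is_tiling 0 S \<and> num_fences S = 0} = {{}}"
    by (auto simp: is_tiling_0_iff num_fences_def)
  then show ?thesis by (simp add: T_def)
qed

lemma finite_tilings: "finite {S. is_tiling N S \<and> num_fences S = k}"
proof (rule finite_subset)
  show "{S. is_tiling N S \<and> num_fences S = k} \<subseteq> Pow (Square ` {1..N} \<union> Fence ` {1..N})"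
  proof (intro subsetI PowI)
    fix S t assume "S \<in> {S. is_tiling N S \<and> num_fences S = k}" "t \<in> S"
    then have "cells t \<subseteq> {1..N}" by (auto simp: is_tiling_def)
    then show "t \<in> Square ` {1..N} \<union> Fence ` {1..N}" by (cases t) auto
  qed
qed simp

definition riordan :: "'a::field fps \<Rightarrow> 'a fps \<Rightarrow> nat \<Rightarrow> nat \<Rightarrow> 'a" where
  "riordan p q n k = fps_nth (p * q ^ k) n"

definition R_bar :: "nat \<Rightarrow> nat \<Rightarrow> rat" where
  "R_bar = riordan (1 / ((1 - fps_X) * (1 - fps_X ^ 2))) (fps_X / (1 - fps_X) ^ 2)"

end

theory Submission
  imports Defs
begin

text \<open>
  A tiling is determined by the set of left posts of its fences, which can be any subset of
  \<open>{1..N - 2}\<close> without two elements differing by 2. Since a board splits into a square, a fence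
  around a square, or two interlocked fences, followed by a shorter board, the generating
  function of the tilings is \<open>1 / (1 - z - y z^3 - y^2 z^4)\<close>, and the denominator factors as
  \<open>(1 + y z^2) (1 - z - y z^2)\<close>. Hence \<open>T (N + 2) (k + 1) + T N k\<close> is a single binomial
  coefficient. Multiplying the generating function of column \<open>m\<close> of the Riordan array by
  \<open>1 + x\<close> leaves \<open>x^m / (1 - x)^(2 m + 2)\<close>, so that \<open>R_bar\<close> satisfies the same recurrence.
\<close>

section \<open>Tilings encoded by the left posts of their fences\<close>

definition sparse :: "nat \<Rightarrow> nat \<Rightarrow> nat set set" where
  "sparse M k = {A. A \<subseteq> {1..M} \<and> (\<forall>i\<in>A. i + 2 \<notin> A) \<and> card A = k}"

definition tiling_of :: "nat \<Rightarrow> nat set \<Rightarrow> tile set" where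
  "tiling_of N A = Fence ` A \<union> Square ` {i \<in> {1..N}. i \<notin> A \<and> (\<forall>j\<in>A. i \<noteq> j + 2)}"

lemma num_fences_eq: "num_fences S = card {i. Fence i \<in> S}"
proof -
  have "{t \<in> S. \<exists>i. t = Fence i} = Fence ` {i. Fence i \<in> S}" by auto
  then show ?thesis by (simp add: num_fences_def card_image inj_on_def)
qed

lemma is_tiling_tiling_of:
  assumes "A \<subseteq> {1..N - 2}" "\<forall>i\<in>A. i + 2 \<notin> A"
  shows "is_tiling N (tiling_of N A)"
  unfolding is_tiling_def
proof (intro conjI ballI)
  fix t assume "t \<in> tiling_of N A"
  then show "cells t \<subseteq> {1..N}" using assms(1) by (force simp: tiling_of_def)
next
  fix c assume c: "c \<in> {1..N}"
  consider "c \<in> A" | j where "j \<in> A" "c = j + 2" | "c \<notin> A" "\<forall>j\<in>A. c \<noteq> j + 2" by blast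
  then show "\<exists>!t. t \<in> tiling_of N A \<and> c \<in> cells t"
  proof cases
    case 1
    then show ?thesis using assms(2)
      by (intro ex1I[of _ "Fence c"]) (auto simp: tiling_of_def)
  next
    case 2
    then show ?thesis using assms(2)
      by (intro ex1I[of _ "Fence j"]) (auto simp: tiling_of_def)
  next
    case 3
    then show ?thesis using c
      by (intro ex1I[of _ "Square c"]) (auto simp: tiling_of_def)
  qed
qed

text \<open>Fences starting at \<open>i\<close> and \<open>i + 2\<close> would both cover cell
  \<open>i + 2\<close>. A cell that is no post can only be covered by a square, so the fences
  determine the whole tiling.\<close>

lemma fences_of_tiling:
  assumes "is_tiling N S"
  shows "{i. Fence i \<in> S} \<subseteq> {1..N - 2}" and "\<forall>i. Fence i \<in> S \<longrightarrow> Fence (i + 2) \<notin> S"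
    and "tiling_of N {i. Fence i \<in> S} = S"
proof -
  have sub: "cells t \<subseteq> {1..N}" if "t \<in> S" for t
    using assms that by (auto simp: is_tiling_def)
  have cover: "\<exists>t. t \<in> S \<and> c \<in> cells t" if "c \<in> {1..N}" for c
    using assms that by (auto simp: is_tiling_def)
  have uniq: "t = u" if "t \<in> S" "u \<in> S" "c \<in> cells t" "c \<in> cells u" for t u c
  proof -
    have "c \<in> {1..N}" using sub that by blast
    then show ?thesis using assms that unfolding is_tiling_def by blast
  qed
  show "{i. Fence i \<in> S} \<subseteq> {1..N - 2}"
    using sub by fastforce
  show "\<forall>i. Fence i \<in> S \<longrightarrow> Fence (i + 2) \<notin> S"
    using uniq[of "Fence i" "Fence (i + 2)" "i + 2" for i] by auto
  show "tiling_of N {i. Fence i \<in> S} = S"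
  proof (intro set_eqI)
    fix t
    show "t \<in> tiling_of N {i. Fence i \<in> S} \<longleftrightarrow> t \<in> S"
    proof (cases t)
      case (Fence i)
      then show ?thesis by (auto simp: tiling_of_def)
    next
      case (Square i)
      have "Square i \<in> S \<longleftrightarrow> i \<in> {1..N} \<and> Fence i \<notin> S \<and> (\<forall>j. Fence j \<in> S \<longrightarrow> i \<noteq> j + 2)"
      proof (intro iffI conjI)
        assume S: "Square i \<in> S"
        show "i \<in> {1..N}" using sub[OF S] by simp
        show "Fence i \<notin> S" using uniq[OF S, of "Fence i" i] by auto
        show "\<forall>j. Fence j \<in> S \<longrightarrow> i \<noteq> j + 2" using uniq[OF S, of _ i] by fastforce
      next
        assume i: "i \<in> {1..N} \<and> Fence i \<notin> S \<and> (\<forall>j. Fence j \<in> S \<longrightarrow> i \<noteq> j + 2)"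
        then obtain u where "u \<in> S" "i \<in> cells u" using cover by blast
        then show "Square i \<in> S" using i by (cases u) auto
      qed
      then show ?thesis using Square by (auto simp: tiling_of_def)
    qed
  qed
qed

text \<open>The truncated subtraction is harmless: for \<open>N \<le> 2\<close> no fence fits, and
  \<open>{1..N - 2}\<close> is empty.\<close>

lemma T_eq_card_sparse: "T N k = card (sparse (N - 2) k)"
proof -
  have "bij_betw (tiling_of N) (sparse (N - 2) k) {S. is_tiling N S \<and> num_fences S = k}"
  proof (rule bij_betw_byWitness[where f' = "\<lambda>S. {i. Fence i \<in> S}"])
    have fences: "{i. Fence i \<in> tiling_of N A} = A" for A
      by (auto simp: tiling_of_def)
    then show "\<forall>A\<in>sparse (N - 2) k. {i. Fence i \<in> tiling_of N A} = A" by blast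
    show "\<forall>S\<in>{S. is_tiling N S \<and> num_fences S = k}. tiling_of N {i. Fence i \<in> S} = S"
      using fences_of_tiling(3) by blast
    show "tiling_of N ` sparse (N - 2) k \<subseteq> {S. is_tiling N S \<and> num_fences S = k}"
      by (auto simp: sparse_def is_tiling_tiling_of num_fences_eq fences)
    show "(\<lambda>S. {i. Fence i \<in> S}) ` {S. is_tiling N S \<and> num_fences S = k} \<subseteq> sparse (N - 2) k"
      using fences_of_tiling(1,2) by (fastforce simp: sparse_def num_fences_eq)
  qed
  then show ?thesis by (simp add: T_def bij_betw_same_card)
qed

section \<open>Counting sparse sets\<close>

lemma finite_sparse: "finite (sparse M k)"
  by (rule finite_subset[of _ "Pow {1..M}"]) (auto simp: sparse_def)

lemma sparse_0_right: "sparse M 0 = {{}}"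
  by (auto simp: sparse_def dest: finite_subset)

lemma sparse_eq_empty:
  assumes "M < k"
  shows "sparse M k = {}"
  using assms card_mono[of "{1..M}"] by (fastforce simp: sparse_def)

lemma card_sparse_1: "card (sparse M 1) = M"
proof -
  have "sparse M 1 = (\<lambda>i. {i}) ` {1..M}"
    by (auto simp: sparse_def card_1_singleton_iff)
  then show ?thesis by (simp add: card_image)
qed

text \<open>Sparse sets are split according to which of the two largest possible left posts,
  \<open>N + 2\<close> and \<open>N + 1\<close>, they contain. On the board, its right end is a
  square (\<open>F\<close>), a fence around a square (\<open>G\<close>), or two interlocked fences
  (\<open>H\<close>).\<close>

lemma T_rec: "T (N + 4) (k + 2) = T (N + 3) (k + 2) + T (N + 1) (k + 1) + T N k"
proof -
  define F where "F = sparse (N + 1) (k + 2)"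
  define G where "G = insert (N + 2) ` sparse (N - 1) (k + 1)"
  define H where "H = (\<lambda>A. insert (N + 2) (insert (N + 1) A)) ` sparse (N - 2) k"
  have fin: "finite A" if "A \<in> sparse M k" for A M k
    using that by (auto simp: sparse_def intro: finite_subset)
  have notin: "j \<notin> A" if "A \<in> sparse M k" "M < j" for A M k j
    using that by (auto simp: sparse_def)
  have "sparse (N + 2) (k + 2) = F \<union> G \<union> H"
  proof (intro equalityI subsetI)
    fix A assume A: "A \<in> sparse (N + 2) (k + 2)"
    then have finA: "finite A" by (rule fin)
    have le: "i \<le> N + 2" "1 \<le> i" if "i \<in> A" for i using A that by (auto simp: sparse_def)
    have gap: "i + 2 \<notin> A" if "i \<in> A" for i using A that by (auto simp: sparse_def)
    have card: "card A = k + 2" using A by (auto simp: sparse_def)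
    consider "N + 2 \<notin> A" | "N + 2 \<in> A" "N + 1 \<notin> A" | "N + 2 \<in> A" "N + 1 \<in> A" by blast
    then show "A \<in> F \<union> G \<union> H"
    proof cases
      case 1
      then have "i \<le> N + 1" if "i \<in> A" for i using le(1)[OF that] that
        by (cases "i = N + 2") auto
      then have "A \<in> F" using le gap card by (auto simp: F_def sparse_def)
      then show ?thesis by blast
    next
      case 2
      have "A - {N + 2} \<subseteq> {1..N - 1}"
      proof
        fix i assume that: "i \<in> A - {N + 2}"
        \<comment> \<open>\<open>i = N\<close> is impossible because \<open>i + 2\<close> would be
          the post \<open>N + 2\<close>.\<close>
        have "i \<noteq> N + 2" "i \<noteq> N + 1" "i \<noteq> N" using that 2 gap[of i] by auto
        then show "i \<in> {1..N - 1}" using le[of i] that by auto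
      qed
      then have "A - {N + 2} \<in> sparse (N - 1) (k + 1)"
        using gap card 2 finA by (auto simp: sparse_def)
      moreover have "A = insert (N + 2) (A - {N + 2})" using 2 by auto
      ultimately show ?thesis unfolding G_def by blast
    next
      case 3
      have "A - {N + 2} - {N + 1} \<subseteq> {1..N - 2}"
      proof
        fix i assume that: "i \<in> A - {N + 2} - {N + 1}"
        have "i \<noteq> N + 2" "i \<noteq> N + 1" "i \<noteq> N" "i + 1 \<noteq> N" using that 3 gap[of i] by auto
        then show "i \<in> {1..N - 2}" using le[of i] that by auto
      qed
      then have "A - {N + 2} - {N + 1} \<in> sparse (N - 2) k"
        using gap card 3 finA by (auto simp: sparse_def)
      moreover have "A = insert (N + 2) (insert (N + 1) (A - {N + 2} - {N + 1}))" using 3 by auto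
      ultimately show ?thesis unfolding H_def by blast
    qed
  next
    fix A assume "A \<in> F \<union> G \<union> H"
    then consider "A \<in> F" | "A \<in> G" | "A \<in> H" by blast
    then show "A \<in> sparse (N + 2) (k + 2)"
    proof cases
      case 1
      then show ?thesis by (auto simp: F_def sparse_def)
    next
      case 2
      then obtain B where B: "B \<in> sparse (N - 1) (k + 1)" "A = insert (N + 2) B"
        by (auto simp: G_def)
      \<comment> \<open>The bound \<open>1 \<le> i\<close> matters: for \<open>N = 0\<close> the
        truncated \<open>N - 1\<close> alone would admit \<open>i = 0\<close>, which conflicts with
        \<open>N + 2\<close>.\<close>
      have "i \<le> N - 1 \<and> 1 \<le> i" if "i \<in> B" for i using B(1) that by (auto simp: sparse_def)
      then show ?thesis using B fin[OF B(1)] notin[OF B(1)]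
        by (fastforce simp: sparse_def)
    next
      case 3
      then obtain B where B: "B \<in> sparse (N - 2) k" "A = insert (N + 2) (insert (N + 1) B)"
        by (auto simp: H_def)
      have "i \<le> N - 2 \<and> 1 \<le> i" if "i \<in> B" for i using B(1) that by (auto simp: sparse_def)
      then show ?thesis using B fin[OF B(1)] notin[OF B(1)]
        by (fastforce simp: sparse_def)
    qed
  qed
  moreover have "F \<inter> G = {}" "F \<inter> H = {}"
    by (auto simp: F_def G_def H_def dest: notin)
  moreover have "G \<inter> H = {}"
  proof -
    have "N + 1 \<notin> A" if "A \<in> G" for A
      using that notin[of _ "N - 1" _ "N + 1"] by (auto simp: G_def)
    moreover have "N + 1 \<in> A" if "A \<in> H" for A
      using that by (auto simp: H_def)
    ultimately show ?thesis by blast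
  qed
  moreover have "finite F" "finite G" "finite H"
    by (simp_all add: F_def G_def H_def finite_sparse)
  moreover have "card G = card (sparse (N - 1) (k + 1))" unfolding G_def
  proof (intro card_image inj_onI)
    fix A B assume "A \<in> sparse (N - 1) (k + 1)" "B \<in> sparse (N - 1) (k + 1)"
      "insert (N + 2) A = insert (N + 2) B"
    then show "A = B" using notin[of _ "N - 1" _ "N + 2"] by (simp add: insert_ident)
  qed
  moreover have "card H = card (sparse (N - 2) k)" unfolding H_def
  proof (intro card_image inj_onI)
    fix A B assume "A \<in> sparse (N - 2) k" "B \<in> sparse (N - 2) k"
      "insert (N + 2) (insert (N + 1) A) = insert (N + 2) (insert (N + 1) B)"
    then show "A = B" using notin[of _ "N - 2" _ "N + 2"] notin[of _ "N - 2" _ "N + 1"]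
      by (simp add: insert_ident)
  qed
  ultimately show ?thesis
    by (simp add: T_eq_card_sparse card_Un_disjoint Int_Un_distrib2 F_def)
qed

text \<open>The sum on the left satisfies Pascal's rule: this is the recurrence left after the
  factor \<open>1 + y z^2\<close> is removed from the denominator of the generating
  function.\<close>

lemma T_add_T:
  "T (N + 2) (k + 1) + T N k = (N + 1 - k) choose (k + 1)"
proof (induction N arbitrary: k rule: less_induct)
  case (less N)
  consider "N \<le> 1" | M where "N = M + 2"
    by (metis add.commute le_Suc_ex not_less_eq_eq numeral_2_eq_2 One_nat_def)
  then show ?case
  proof cases
    case 1
    then consider "N = 0" | "N = 1" by linarith
    then show ?thesis
      \<comment> \<open>Here the boards have at most 3 cells, hence room for at most one
        fence.\<close>
      by cases (cases k; cases "k = 1"; simp add: T_eq_card_sparse sparse_eq_empty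
          sparse_0_right card_sparse_1[simplified] binomial_eq_0)+
  next
    case 2
    show ?thesis
    proof (cases k)
      case 0
      then show ?thesis using 2 card_sparse_1[of N] by (simp add: T_eq_card_sparse sparse_0_right)
    next
      case (Suc j)
      have "T (M + 3) (j + 2) + T (M + 1) (j + 1) = (M + 1 - j) choose (j + 2)"
        using less[of "M + 1" "j + 1"] 2 by (simp add: eval_nat_numeral)
      moreover have "T (M + 2) (j + 1) + T M j = (M + 1 - j) choose (j + 1)"
        using less[of M j] 2 by simp
      \<comment> \<open>Adding \<open>T (M + 2) (j + 1)\<close> to both sides of
        \<open>T_rec\<close> groups its right side into the two sums just evaluated.\<close>
      ultimately have "T (M + 4) (j + 2) + T (M + 2) (j + 1)
          = ((M + 1 - j) choose (j + 2)) + ((M + 1 - j) choose (j + 1))"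
        using T_rec[of M j] by linarith
      also have "\<dots> = (M + 2 - j) choose (j + 2)"
        \<comment> \<open>For \<open>j > M + 1\<close> both truncated differences are 0 and all the
          binomials vanish.\<close>
        by (cases "j \<le> M + 1") (simp_all add: Suc_diff_le binomial_eq_0)
      finally show ?thesis using 2 Suc by (simp add: eval_nat_numeral)
    qed
  qed
qed

section \<open>Columns of the Riordan array\<close>

lemma R_bar_gf:
  "1 / ((1 - fps_X) * (1 - fps_X ^ 2)) * (fps_X / (1 - fps_X) ^ 2) ^ m
    = fps_X ^ m * (inverse ((1 - fps_X :: rat fps) ^ (2 * m + 2)) * inverse (1 + fps_X))"
proof -
  \<comment> \<open>This isolates \<open>1 + fps_X\<close>, the only factor that keeps the column
    from being a pure negative binomial series.\<close>
  have "1 - fps_X ^ 2 = (1 - fps_X :: rat fps) * (1 + fps_X)"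
    by (simp add: algebra_simps power2_eq_square)
  then show ?thesis
    by (simp add: fps_divide_unit fps_inverse_mult power_mult_distrib power_add power_mult
        flip: fps_inverse_power)
qed

lemma R_bar_0: "R_bar m m = 1"
  by (simp add: R_bar_def riordan_def R_bar_gf fps_X_power_mult_nth fps_power_zeroth)

text \<open>Multiplying by \<open>1 + fps_X\<close> adds neighbouring coefficients of the column and
  cancels that factor, leaving a coefficient of \<open>(1 - x)^(-(2 m + 2))\<close>.\<close>

lemma R_bar_add_R_bar:
  "R_bar (m + k + 1) m + R_bar (m + k) m = of_nat ((2 * m + k + 2) choose (k + 1))"
proof -
  define P where "P = inverse ((1 - fps_X :: rat fps) ^ (2 * m + 2))"
  have nth: "R_bar (m + j) m = fps_nth (P * inverse (1 + fps_X)) j" for j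
    by (simp add: R_bar_def riordan_def R_bar_gf P_def fps_X_power_mult_nth)
  have "(1 + fps_X) * (P * inverse (1 + fps_X)) = P"
    by (simp add: mult.left_commute inverse_mult_eq_1')
  then have "fps_nth ((1 + fps_X) * (P * inverse (1 + fps_X))) (k + 1) = fps_nth P (k + 1)"
    by (rule arg_cong)
  moreover have "P = Abs_fps (\<lambda>j. of_nat ((2 * m + j + 1) choose j))"
    using one_minus_const_fps_X_neg_power'[of "2 * m + 2" "1::rat"] by (simp add: P_def)
  ultimately show ?thesis
    using nth[of k] nth[of "k + 1"] by (simp add: distrib_right)
qed

theorem theorem6p10:
  fixes n k :: nat
  assumes "k \<le> n"
  shows "of_nat (T (2 * n + 1) k) = R_bar n (n - k)"
  using assms
proof (induction k arbitrary: n)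
  case 0
  then show ?case by (simp add: R_bar_0 T_eq_card_sparse sparse_0_right)
next
  case (Suc k)
  \<comment> \<open>The column \<open>m\<close> is unchanged when \<open>n\<close> and
    \<open>Suc k\<close> both drop by 1, so the induction hypothesis at row \<open>m + k\<close>
    concerns the same column. With \<open>N = 2 * (m + k) + 1\<close>, both recurrences have the
    same binomial on the right.\<close>
  define m where "m = n - Suc k"
  have n: "n = m + k + 1" using Suc.prems by (simp add: m_def)
  have "of_nat (T (2 * n + 1) (Suc k)) + of_nat (T (2 * (m + k) + 1) k)
      = (of_nat ((2 * m + k + 2) choose (k + 1)) :: rat)"
    using T_add_T[of "2 * (m + k) + 1" k]
    by (simp add: n algebra_simps flip: of_nat_add)
  also have "\<dots> = R_bar n m + R_bar (m + k) m"
    using R_bar_add_R_bar[of m k] by (simp add: n)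
  also have "R_bar (m + k) m = of_nat (T (2 * (m + k) + 1) k)"
    using Suc.IH[of "m + k"] by simp
  finally show ?case by (simp add: n)
qed

end
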